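(* Let $(\omega_n)_{n\ge 0}$ be any sequence with $\omega_n\in\{-1,1\}$ for each $n$, and let $$f(x)=\sum_{n=0}^\infty 2^{-n}\omega_n\,\phi(2^n x),\qquad 0\le x\le 1.$$ Then $$\max_{y\in\mathbb{R}}\ \dim_H L_f(y)=\frac12 .$$ Moreover, the maximum is attained at a set of $y$-values which is dense in the range of $f$ (that is, $\{y:\dim_H L_f(y)=1/2\}$ is dense in $f([0,1])$), and in particular it is attained at $$y=\sum_{n=0}^\infty \frac{\omega_{2n}+\omega_{2n+1}}{4^{n+1}}.$$
   Context: $\phi(x)=\operatorname{dist}(x,\mathbb{Z})$ is the distance from $x\in\mathbb{R}$ to the nearest integer. For $f:[0,1]\to\mathbb{R}$ and $y\in\mathbb{R}$, $L_f(y)=\{x\in[0,1]: f(x)=y\}$. $\dim_H$ denotes Hausdorff dimension (with the convention $\dim_H\emptyset=0$). *)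

theory Defs
  imports "HOL-Analysis.Analysis"
begin

text \<open>
  The weight \<open>(diam U)\<^sup>s\<close> of a covering set. By convention the empty set has weight \<open>0\<close> for all
  \<open>s\<close>, and \<open>(diam U)\<^sup>0 = 1\<close> for nonempty \<open>U\<close>; the case \<open>s = 0\<close> is separate because
  \<open>0 powr 0 = 0\<close> in HOL.
\<close>

definition hausdorff_weight :: "real \<Rightarrow> 'a::metric_space set \<Rightarrow> ennreal" where
  "hausdorff_weight s U =
     (if U = {} then 0 else if s = 0 then 1 else ennreal (diameter U powr s))"

text \<open>
  Boundedness is required explicitly since \<^const>\<open>diameter\<close> is only meaningful on bounded sets.
  Finite covers are included, as members of the sequence may be empty.
\<close>

definition delta_covers :: "real \<Rightarrow> 'a::metric_space set \<Rightarrow> (nat \<Rightarrow> 'a set) set" where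
  "delta_covers \<delta> A =
     {U. A \<subseteq> (\<Union>i. U i) \<and> (\<forall>i. bounded (U i) \<and> diameter (U i) \<le> \<delta>)}"

definition hausdorff_premeasure :: "real \<Rightarrow> real \<Rightarrow> 'a::metric_space set \<Rightarrow> ennreal" where
  "hausdorff_premeasure s \<delta> A =
     (INF U \<in> delta_covers \<delta> A. \<Sum>i. hausdorff_weight s (U i))"

definition hausdorff_measure :: "real \<Rightarrow> 'a::metric_space set \<Rightarrow> ennreal" where
  "hausdorff_measure s A = (SUP \<delta> \<in> {0<..}. hausdorff_premeasure s \<delta> A)"

definition hausdorff_dim :: "'a::metric_space set \<Rightarrow> ereal" where
  "hausdorff_dim A = (INF s \<in> {s. 0 \<le> s \<and> hausdorff_measure s A = 0}. ereal s)"

lemma hausdorff_dim_empty: "hausdorff_dim ({} :: 'a::metric_space set) = 0"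
proof -
  have "hausdorff_premeasure 0 \<delta> ({} :: 'a set) = 0" if "\<delta> > 0" for \<delta>
  proof -
    have "(\<lambda>_. {}) \<in> delta_covers \<delta> ({} :: 'a set)"
      using that by (simp add: delta_covers_def)
    then have "hausdorff_premeasure 0 \<delta> ({} :: 'a set)
        \<le> (\<Sum>i::nat. hausdorff_weight 0 ({} :: 'a set))"
      unfolding hausdorff_premeasure_def by (rule INF_lower2) simp
    then show ?thesis by (simp add: hausdorff_weight_def)
  qed
  then have "hausdorff_measure 0 ({} :: 'a set) = 0"
    by (simp add: hausdorff_measure_def SUP_eq_const)
  then show ?thesis
    unfolding hausdorff_dim_def
    by (intro antisym INF_lower2[of 0] INF_greatest) (auto simp: zero_ereal_def)
qed

definition dist_int :: "real \<Rightarrow> real" where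
  "dist_int x = infdist x \<int>"

definition signed_takagi :: "(nat \<Rightarrow> real) \<Rightarrow> real \<Rightarrow> real" where
  "signed_takagi \<omega> x = (\<Sum>n. \<omega> n / 2 ^ n * dist_int (2 ^ n * x))"

definition level_set :: "(real \<Rightarrow> real) \<Rightarrow> real \<Rightarrow> real set" where
  "level_set f y = {x \<in> {0..1}. f x = y}"

end

theory Submission
  imports Defs
begin

text \<open>
  Both bounds come from the partial sums of the first \<open>2 n\<close> terms. Such a sum is a polygon with
  vertices over the grid of mesh \<open>4\<^sup>-\<^sup>n\<close>, and after scaling by \<open>4\<^sup>n / 2\<close> its heights are integers. Passing
  from \<open>n\<close> to \<open>n + 1\<close> cuts each segment into quarters and adds one of four small bumps, fixed by two
  signs; over each segment the graph of \<open>f\<close> is the segment plus a small copy of a graph of the same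
  kind (\<open>signed_takagi_on_segment\<close>).

  Upper bound. Distinguish flat segments from segments that cross strips of unit height. A segment
  that is not flat stays monotone after a refinement, so it contributes one crossing to each of the finer strips in its
  range. A flat segment contributes two flat pieces at one height and two new crossings. A
  segment of slope \<open>\<plusminus>1\<close> also contributes one flat piece, but at a height in a different residue class
  modulo 4, so the two sources of flat pieces never add up. The numbers of flat segments
  at a height and of crossings of a strip are therefore at most \<open>2\<^sup>n\<close> and \<open>2 \<cdot> 2\<^sup>n\<close> (\<open>count_bounds\<close>). A level
  set is thus covered by \<open>O(2\<^sup>n)\<close> intervals of length \<open>4\<^sup>-\<^sup>n\<close>, and its dimension is at most \<open>1/2\<close>.

  Lower bound. Each flat segment has two flat quarters of common height. Following them forever yields a
  Cantor set with two pieces of ratio \<open>1/4\<close> at each step, contained in one level set. Its parametrisation by binary expansions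
  has a Hoelder inverse of exponent \<open>1/2\<close> (\<open>cantor_parametrisation\<close>), whence dimension at least \<open>1/2\<close>. Starting from the flat segment \<open>[0, 1]\<close>
  the heights add up to the value in the statement.

  Density. Every segment contains a flat one at a finer scale (\<open>flat_descendant\<close>), so levels of
  dimension \<open>1/2\<close> are attained in every interval of the domain, and continuity of \<open>f\<close> makes them dense in its range.
\<close>

section \<open>Bounds for the Hausdorff dimension\<close>

text \<open>
  Covering by \<open>C \<rho>\<^sup>-\<^sup>d\<close> sets of diameter \<open>\<rho>\<close> costs at most \<open>C \<rho>\<^sup>s\<^sup>-\<^sup>d\<close> in dimension \<open>s\<close>, which vanishes
  with \<open>\<rho>\<close> as soon as \<open>s > d\<close>.
\<close>

lemma hausdorff_dim_le_box_counting:
  fixes A :: "'a::metric_space set"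
  assumes d: "0 \<le> d" and \<rho>: "\<rho> \<longlonglongrightarrow> 0" "\<And>n. 0 < \<rho> n"
    and cover: "\<And>n. \<exists>F. finite F \<and> real (card F) \<le> C * \<rho> n powr - d \<and> A \<subseteq> \<Union>F \<and>
                    (\<forall>U\<in>F. bounded U \<and> diameter U \<le> \<rho> n)"
  shows "hausdorff_dim A \<le> ereal d"
proof -
  have null: "hausdorff_premeasure s \<delta> A = 0" if s: "d < s" and \<delta>: "0 < \<delta>" for s \<delta>
  proof -
    have bound: "hausdorff_premeasure s \<delta> A \<le> ennreal (C * \<rho> n powr (s - d))" if n: "\<rho> n \<le> \<delta>" for n
    proof -
      obtain F where F: "finite F" "real (card F) \<le> C * \<rho> n powr - d" "A \<subseteq> \<Union>F"
        and FU: "\<And>U. U \<in> F \<Longrightarrow> bounded U" "\<And>U. U \<in> F \<Longrightarrow> diameter U \<le> \<rho> n"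
        using cover[of n] by blast
      obtain h where h: "bij_betw h {..<card F} F"
        using ex_bij_betw_nat_finite[OF F(1)] by (auto simp: atLeast0LessThan)
      define U where "U i = (if i < card F then h i else {})" for i
      have hF: "h i \<in> F" if "i < card F" for i
        using h that by (auto simp: bij_betw_def)
      have "U \<in> delta_covers \<delta> A"
      proof -
        have "A \<subseteq> (\<Union>i. U i)"
        proof
          fix x assume "x \<in> A"
          then obtain V where V: "V \<in> F" "x \<in> V" using F(3) by blast
          then have "V \<in> h ` {..<card F}" using h by (simp add: bij_betw_def)
          then obtain i where "i < card F" "h i = V" by auto
          then show "x \<in> (\<Union>i. U i)" using V by (auto simp: U_def)
        qed
        moreover have "bounded (U i) \<and> diameter (U i) \<le> \<delta>" for i
          using FU hF[of i] n \<delta> by (auto simp: U_def intro: order_trans)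
        ultimately show ?thesis by (simp add: delta_covers_def)
      qed
      then have "hausdorff_premeasure s \<delta> A \<le> (\<Sum>i. hausdorff_weight s (U i))"
        unfolding hausdorff_premeasure_def by (rule INF_lower)
      also have "\<dots> = (\<Sum>i<card F. hausdorff_weight s (U i))"
        by (rule suminf_finite) (auto simp: U_def hausdorff_weight_def)
      also have "\<dots> \<le> (\<Sum>i<card F. ennreal (\<rho> n powr s))"
      proof (rule sum_mono)
        fix i assume "i \<in> {..<card F}"
        then have "bounded (U i)" "diameter (U i) \<le> \<rho> n" using FU hF[of i] by (auto simp: U_def)
        then have "diameter (U i) powr s \<le> \<rho> n powr s"
          using s d by (intro powr_mono2 diameter_ge_0) auto
        then show "hausdorff_weight s (U i) \<le> ennreal (\<rho> n powr s)"
          using s d by (auto simp: hausdorff_weight_def intro: ennreal_leI)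
      qed
      also have "\<dots> = ennreal (real (card F) * \<rho> n powr s)"
        by (simp add: ennreal_mult ennreal_of_nat_eq_real_of_nat)
      also have "\<dots> \<le> ennreal (C * \<rho> n powr - d * \<rho> n powr s)"
        using F(2) by (intro ennreal_leI mult_right_mono) auto
      also have "C * \<rho> n powr - d * \<rho> n powr s = C * \<rho> n powr (s - d)"
        by (simp add: powr_add[symmetric] mult.assoc)
      finally show ?thesis .
    qed
    have "(\<lambda>n. ennreal (C * \<rho> n powr (s - d))) \<longlonglongrightarrow> ennreal (C * 0)"
      using s \<rho> by (intro tendsto_ennrealI tendsto_mult tendsto_const tendsto_zero_powrI[where b = "s - d"])
        (auto intro!: always_eventually less_imp_le)
    moreover have "\<forall>\<^sub>F n in sequentially. hausdorff_premeasure s \<delta> A \<le> ennreal (C * \<rho> n powr (s - d))"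
      using order_tendstoD(2)[OF \<rho>(1) \<delta>] by eventually_elim (intro bound less_imp_le)
    ultimately have "hausdorff_premeasure s \<delta> A \<le> ennreal (C * 0)"
      by (intro tendsto_lowerbound) auto
    then show ?thesis by simp
  qed
  have le: "hausdorff_dim A \<le> ereal s" if "d < s" for s
  proof -
    have "hausdorff_premeasure s \<delta> A = 0" if "\<delta> \<in> {0<..}" for \<delta>
      using null[OF \<open>d < s\<close>] that by simp
    then have "hausdorff_measure s A = 0"
      unfolding hausdorff_measure_def by (subst SUP_eq_const[where x = 0]) auto
    then show ?thesis
      unfolding hausdorff_dim_def using that d by (intro INF_lower) simp
  qed
  show ?thesis
  proof (rule ereal_le_epsilon2)
    fix e :: real assume "0 < e"
    then show "hausdorff_dim A \<le> ereal d + ereal e" using le[of "d + e"] by simp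
  qed
qed

text \<open>
  A mass distribution principle that replaces the measure on \<open>A\<close> by a parametrisation: a cover of \<open>A\<close>
  pulls back along \<open>G\<close> to a cover of the unit interval by sets of length \<open>O((diam U)\<^sup>d)\<close>, and these
  lengths add up to at least 1.
\<close>

lemma hausdorff_dim_ge_holder_inverse:
  fixes A :: "'a::metric_space set" and G :: "real \<Rightarrow> 'a"
  assumes d: "0 < d" and C: "0 < C"
    and GA: "\<And>t. t \<in> {0..<1} \<Longrightarrow> G t \<in> A"
    and G: "\<And>s t. s \<in> {0..<1} \<Longrightarrow> t \<in> {0..<1} \<Longrightarrow> \<bar>s - t\<bar> \<le> C * dist (G s) (G t) powr d"
  shows "ereal d \<le> hausdorff_dim A"
proof -
  have pos: "hausdorff_measure s A \<noteq> 0" if s: "0 \<le> s" "s \<le> d" for s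
  proof -
    have "ennreal (1 / (2 * C)) \<le> (\<Sum>i. hausdorff_weight s (U i))" if "U \<in> delta_covers 1 A" for U
    proof -
      have U: "A \<subseteq> (\<Union>i. U i)" "\<And>i. bounded (U i)" "\<And>i. diameter (U i) \<le> 1"
        using that by (auto simp: delta_covers_def)
      have "\<forall>i. \<exists>B. {t \<in> {0..<1}. G t \<in> U i} \<subseteq> B \<and> B \<in> sets lborel \<and>
              emeasure lborel B \<le> ennreal (2 * C) * hausdorff_weight s (U i)"
      proof
        fix i
        show "\<exists>B. {t \<in> {0..<1}. G t \<in> U i} \<subseteq> B \<and> B \<in> sets lborel \<and>
              emeasure lborel B \<le> ennreal (2 * C) * hausdorff_weight s (U i)"
        proof (cases "\<exists>t0\<in>{0..<1}. G t0 \<in> U i")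
          case True
          then obtain t0 where t0: "t0 \<in> {0..<1}" "G t0 \<in> U i" by blast
          define D where "D = diameter (U i)"
          have D: "0 \<le> D" "D \<le> 1" using U by (auto simp: D_def diameter_ge_0)
          have "D powr d \<le> (if s = 0 then 1 else D powr s)"
            using D s d by (auto intro: powr_mono' powr_le1)
          then have w: "ennreal (D powr d) \<le> hausdorff_weight s (U i)"
            using t0 by (auto simp: hausdorff_weight_def D_def ennreal_le_1)
          have "\<bar>t - t0\<bar> \<le> C * D powr d" if "t \<in> {0..<1}" "G t \<in> U i" for t
          proof -
            have "\<bar>t - t0\<bar> \<le> C * dist (G t) (G t0) powr d" using G that t0 by blast
            also have "\<dots> \<le> C * D powr d"
              using C d that t0 U diameter_bounded_bound[of "U i" "G t" "G t0"]
              by (intro mult_left_mono powr_mono2) (auto simp: D_def)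
            finally show ?thesis .
          qed
          then have "{t \<in> {0..<1}. G t \<in> U i} \<subseteq> {t0 - C * D powr d .. t0 + C * D powr d}"
            by (auto simp: abs_le_iff algebra_simps)
          moreover have "emeasure lborel {t0 - C * D powr d .. t0 + C * D powr d} = ennreal (2 * C * D powr d)"
            using C by (simp add: algebra_simps)
          moreover have "\<dots> \<le> ennreal (2 * C) * hausdorff_weight s (U i)"
            using C w by (simp add: ennreal_mult mult_left_mono)
          ultimately show ?thesis
            by (intro exI[of _ "{t0 - C * D powr d .. t0 + C * D powr d}"]) auto
        next
          case False
          then show ?thesis by (intro exI[of _ "{}"]) auto
        qed
      qed
      from choice[OF this] obtain B where
          "\<forall>i. {t \<in> {0..<1}. G t \<in> U i} \<subseteq> B i \<and> B i \<in> sets lborel \<and>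
             emeasure lborel (B i) \<le> ennreal (2 * C) * hausdorff_weight s (U i)" ..
      then have B: "\<And>i. {t \<in> {0..<1}. G t \<in> U i} \<subseteq> B i" "\<And>i. B i \<in> sets lborel"
          "\<And>i. emeasure lborel (B i) \<le> ennreal (2 * C) * hausdorff_weight s (U i)"
        by simp_all
      have "{0..<1} \<subseteq> (\<Union>i. B i)"
      proof
        fix t :: real assume t: "t \<in> {0..<1}"
        then obtain i where "G t \<in> U i" using GA U(1) by blast
        then show "t \<in> (\<Union>i. B i)" using B(1)[of i] t by blast
      qed
      then have "emeasure lborel {0..<1::real} \<le> emeasure lborel (\<Union>i. B i)"
        using B(2) by (intro emeasure_mono) auto
      also have "\<dots> \<le> (\<Sum>i. emeasure lborel (B i))"
        using B(2) by (intro emeasure_subadditive_countably) auto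
      also have "\<dots> \<le> (\<Sum>i. ennreal (2 * C) * hausdorff_weight s (U i))"
        using B(3) by (intro suminf_le) auto
      finally have "1 \<le> ennreal (2 * C) * (\<Sum>i. hausdorff_weight s (U i))" by simp
      then have "ennreal (1 / (2 * C)) * 1 \<le>
          ennreal (1 / (2 * C)) * (ennreal (2 * C) * (\<Sum>i. hausdorff_weight s (U i)))"
        by (intro mult_left_mono) auto
      also have "\<dots> = (\<Sum>i. hausdorff_weight s (U i))"
        using C by (simp add: mult.assoc[symmetric] ennreal_mult[symmetric])
      finally show ?thesis by simp
    qed
    then have "ennreal (1 / (2 * C)) \<le> hausdorff_premeasure s 1 A"
      unfolding hausdorff_premeasure_def by (intro INF_greatest)
    also have "\<dots> \<le> hausdorff_measure s A"
      unfolding hausdorff_measure_def by (intro SUP_upper) auto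
    finally have "ennreal (1 / (2 * C)) \<le> hausdorff_measure s A" .
    then show ?thesis using C by (auto simp: ennreal_eq_0_iff dest!: antisym)
  qed
  show ?thesis
    unfolding hausdorff_dim_def using pos by (intro INF_greatest) (auto intro: leI)
qed

section \<open>Self-similarity\<close>

definition sign_sequence :: "(nat \<Rightarrow> real) \<Rightarrow> bool" where
  "sign_sequence \<omega> \<longleftrightarrow> (\<forall>n. \<omega> n \<in> {-1, 1})"

lemma sign_sequence_shift: "sign_sequence \<omega> \<Longrightarrow> sign_sequence (\<lambda>k. \<omega> (m + k))"
  by (simp add: sign_sequence_def)

lemma dist_int_unit: "dist_int x = min x (1 - x)" if "0 \<le> x" "x \<le> 1"
proof (rule antisym)
  show "dist_int x \<le> min x (1 - x)"
    using that infdist_le[of 0 \<int> x] infdist_le[of 1 \<int> x] by (simp add: dist_int_def dist_real_def)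
  have "min x (1 - x) \<le> dist x b" if "b \<in> \<int>" for b
  proof -
    obtain k where k: "b = of_int k" using \<open>b \<in> \<int>\<close> Ints_cases by blast
    consider "k \<le> 0" | "1 \<le> k" by linarith
    then show ?thesis
    proof cases
      case 1
      then have "b \<le> 0" by (simp add: k)
      then show ?thesis using \<open>0 \<le> x\<close> by (simp add: dist_real_def)
    next
      case 2
      then have "1 \<le> b" by (simp add: k)
      then show ?thesis using \<open>x \<le> 1\<close> by (simp add: dist_real_def)
    qed
  qed
  then show "min x (1 - x) \<le> dist_int x"
    unfolding dist_int_def by (subst infdist_notempty) (auto intro!: cINF_greatest)
qed

lemma dist_int_periodic: "dist_int (x + of_int k) = dist_int x"
proof -
  have "dist_int (y + of_int m) \<le> dist_int y" for y m
  proof -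
    have "dist_int (y + of_int m) \<le> dist y b" if "b \<in> \<int>" for b
    proof -
      have "dist_int (y + of_int m) \<le> dist (y + of_int m) (b + of_int m)"
        unfolding dist_int_def using that by (intro infdist_le) auto
      then show ?thesis by (simp add: dist_real_def)
    qed
    then show ?thesis
      unfolding dist_int_def[of y] by (subst infdist_notempty) (auto intro!: cINF_greatest)
  qed
  from this[of x k] this[of "x + of_int k" "- k"] show ?thesis by simp
qed

lemma dist_int_nonneg: "0 \<le> dist_int x"
  by (simp add: dist_int_def infdist_nonneg)

lemma dist_int_le_half: "dist_int x \<le> 1 / 2"
proof -
  have "dist_int x = dist_int (frac x + of_int \<lfloor>x\<rfloor>)" by (simp add: frac_def)
  also have "\<dots> = min (frac x) (1 - frac x)"
    by (simp only: dist_int_periodic) (intro dist_int_unit frac_ge_0 less_imp_le[OF frac_lt_1])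
  also have "\<dots> \<le> 1 / 2" by linarith
  finally show ?thesis .
qed

lemma takagi_term_bound:
  assumes "sign_sequence \<omega>"
  shows "norm (\<omega> n / 2 ^ n * dist_int (2 ^ n * x)) \<le> 1 / 2 * (1 / 2) ^ n"
proof -
  have "\<bar>\<omega> n\<bar> = 1" using assms unfolding sign_sequence_def
    by (metis abs_1 abs_neg_one insertE singletonD)
  then show ?thesis
    using dist_int_nonneg[of "2 ^ n * x"] dist_int_le_half[of "2 ^ n * x"]
    by (simp add: abs_mult power_one_over divide_simps)
qed

lemma summable_takagi:
  assumes "sign_sequence \<omega>"
  shows "summable (\<lambda>n. \<omega> n / 2 ^ n * dist_int (2 ^ n * x))"
  by (rule summable_comparison_test'[OF _ takagi_term_bound[OF assms]])
    (intro summable_mult summable_geometric, simp)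

lemma signed_takagi_abs_le_1:
  assumes "sign_sequence \<omega>"
  shows "\<bar>signed_takagi \<omega> x\<bar> \<le> 1"
proof -
  have "norm (signed_takagi \<omega> x) \<le> (\<Sum>n. 1 / 2 * (1 / 2 :: real) ^ n)"
    unfolding signed_takagi_def
    by (rule norm_suminf_le[OF takagi_term_bound[OF assms]]) (intro summable_mult summable_geometric, simp)
  also have "\<dots> = 1" by (subst suminf_mult) (auto simp: suminf_geometric intro: summable_geometric)
  finally show ?thesis by simp
qed

lemma continuous_signed_takagi:
  assumes "sign_sequence \<omega>"
  shows "continuous_on UNIV (signed_takagi \<omega>)"
proof -
  have "uniform_limit UNIV (\<lambda>n x. \<Sum>i<n. \<omega> i / 2 ^ i * dist_int (2 ^ i * x)) (signed_takagi \<omega>) sequentially"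
    unfolding signed_takagi_def
    by (rule Weierstrass_m_test[OF takagi_term_bound[OF assms]]) (intro summable_mult summable_geometric, simp)
  then show ?thesis
    by (rule uniform_limit_theorem[rotated]) (auto simp: dist_int_def intro!: always_eventually continuous_intros)
qed

lemma signed_takagi_periodic: "signed_takagi \<omega> (x + of_nat k) = signed_takagi \<omega> x"
proof -
  have "dist_int (2 ^ n * (x + of_nat k)) = dist_int (2 ^ n * x)" for n
    using dist_int_periodic[of "2 ^ n * x" "2 ^ n * int k"] by (simp add: distrib_left)
  then show ?thesis by (simp add: signed_takagi_def)
qed

lemma signed_takagi_two_steps:
  assumes "sign_sequence \<omega>"
  shows "signed_takagi \<omega> x = \<omega> 0 * dist_int x + \<omega> 1 / 2 * dist_int (2 * x)
           + signed_takagi (\<lambda>k. \<omega> (2 + k)) (4 * x) / 4"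
proof -
  define a where "a n = \<omega> n / 2 ^ n * dist_int (2 ^ n * x)" for n
  have "signed_takagi \<omega> x = (\<Sum>n. a (n + 2)) + sum a {..<2}"
    unfolding signed_takagi_def a_def by (rule suminf_split_initial_segment[OF summable_takagi[OF assms]])
  also have "(\<lambda>n. a (n + 2)) = (\<lambda>n. (\<omega> (2 + n) / 2 ^ n * dist_int (2 ^ n * (4 * x))) / 4)"
    by (auto simp: a_def fun_eq_iff power_add mult_ac)
  also have "(\<Sum>n. (\<omega> (2 + n) / 2 ^ n * dist_int (2 ^ n * (4 * x))) / 4)
      = signed_takagi (\<lambda>k. \<omega> (2 + k)) (4 * x) / 4"
    unfolding signed_takagi_def
    by (rule suminf_divide) (rule summable_takagi[OF sign_sequence_shift[OF assms]])
  finally show ?thesis by (simp add: a_def numeral_2_eq_2)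
qed

text \<open>
  Two consecutive terms of the series add, on each interval of a grid, a function that vanishes at the end points and is
  linear on the quarters of the interval. In units of the vertical step of the next grid,
  \<open>bump p q r\<close> is its value at the quarter point \<open>r\<close>, where \<open>p\<close> and \<open>q\<close> are the two signs.
\<close>

definition bump :: "int \<Rightarrow> int \<Rightarrow> nat \<Rightarrow> int" where
  "bump p q r = (if r = 2 then p else if r = 1 \<or> r = 3 then (p + q) div 2 else 0)"

definition refine :: "int \<Rightarrow> int \<Rightarrow> int \<Rightarrow> int \<Rightarrow> nat \<Rightarrow> int" where
  "refine p q u w r = 4 * u + int r * (w - u) + bump p q r"

text \<open>
  Up to scale, \<open>vertex \<omega> n i\<close> is the value of the series at \<open>i / 4\<^sup>n\<close>; the factor \<open>4\<^sup>n / 2\<close> makes it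
  an integer, because the partial sum of \<open>2 n\<close> terms has even slopes on the intervals of length \<open>4\<^sup>-\<^sup>n\<close>.
\<close>

fun vertex :: "(nat \<Rightarrow> real) \<Rightarrow> nat \<Rightarrow> nat \<Rightarrow> int" where
  "vertex \<omega> 0 i = 0"
| "vertex \<omega> (Suc n) i = refine \<lfloor>\<omega> (2 * n)\<rfloor> \<lfloor>\<omega> (2 * n + 1)\<rfloor>
     (vertex \<omega> n (i div 4)) (vertex \<omega> n (i div 4 + 1)) (i mod 4)"

lemma sign_floor:
  assumes "sign_sequence \<omega>"
  shows "\<lfloor>\<omega> n\<rfloor> \<in> {-1, 1}" "of_int \<lfloor>\<omega> n\<rfloor> = \<omega> n"
proof -
  consider "\<omega> n = of_int (-1)" | "\<omega> n = of_int 1" using assms by (force simp: sign_sequence_def)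
  then show "\<lfloor>\<omega> n\<rfloor> \<in> {-1, 1}" "of_int \<lfloor>\<omega> n\<rfloor> = \<omega> n"
    by (cases; simp only: floor_of_int insert_iff simp_thms)+
qed

lemma vertex_refine:
  assumes "r \<le> 4"
  shows "vertex \<omega> (Suc n) (4 * i + r) = refine \<lfloor>\<omega> (2 * n)\<rfloor> \<lfloor>\<omega> (2 * n + 1)\<rfloor>
           (vertex \<omega> n i) (vertex \<omega> n (i + 1)) r"
proof (cases "r = 4")
  case True
  then have "(4 * i + r) div 4 = i + 1" "(4 * i + r) mod 4 = 0" by presburger+
  then show ?thesis using True by (simp add: refine_def bump_def)
next
  case False
  then have "(4 * i + r) div 4 = i" "(4 * i + r) mod 4 = r" using assms by presburger+
  then show ?thesis by simp
qed

lemma bump_interpolates: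
  assumes pq: "p \<in> {-1, 1}" "q \<in> {-1, 1}" and "r < 4" and t: "0 \<le> t" "t \<le> 1"
    and s4: "4 * s = real r + t"
  shows "of_int p * dist_int s + of_int q / 2 * dist_int (2 * s)
           = ((1 - t) * of_int (bump p q r) + t * of_int (bump p q (r + 1))) / 2"
proof -
  have ds: "dist_int s = min s (1 - s)" using s4 t \<open>r < 4\<close> by (intro dist_int_unit) auto
  have "r \<in> {0, 1, 2, 3}" using \<open>r < 4\<close> by auto
  then show ?thesis
  proof (elim insertE emptyE)
    assume r: "r = 0"
    have "dist_int s = s" using s4 t r by (simp add: ds min_def)
    moreover have "dist_int (2 * s) = 2 * s" using s4 t r by (simp add: dist_int_unit min_def)
    ultimately show ?thesis using s4 pq r by (auto simp: bump_def algebra_simps)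
  next
    assume r: "r = 1"
    have "dist_int s = s" using s4 t r by (simp add: ds min_def)
    moreover have "dist_int (2 * s) = 1 - 2 * s" using s4 t r by (simp add: dist_int_unit min_def)
    ultimately show ?thesis using s4 pq r by (auto simp: bump_def algebra_simps)
  next
    assume r: "r = 2"
    have "dist_int s = 1 - s" using s4 t r by (simp add: ds min_def)
    moreover have "dist_int (2 * s) = dist_int (2 * s - 1)" using dist_int_periodic[of "2 * s - 1" 1] by simp
    moreover have "dist_int (2 * s - 1) = 2 * s - 1" using s4 t r by (simp add: dist_int_unit min_def)
    ultimately show ?thesis using s4 pq r by (auto simp: bump_def algebra_simps)
  next
    assume r: "r = 3"
    have "dist_int s = 1 - s" using s4 t r by (simp add: ds min_def)
    moreover have "dist_int (2 * s) = dist_int (2 * s - 1)" using dist_int_periodic[of "2 * s - 1" 1] by simp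
    moreover have "dist_int (2 * s - 1) = 2 - 2 * s" using s4 t r by (simp add: dist_int_unit min_def)
    ultimately show ?thesis using s4 pq r by (auto simp: bump_def algebra_simps)
  qed
qed

text \<open>
  Over each interval of the 4-adic grid the graph is a line segment between two consecutive vertices
  plus a copy, shrunk by \<open>4\<^sup>n\<close> in both directions, of the graph that belongs to the shifted signs. This
  turns questions about level sets into questions about the integer polygons.
\<close>

lemma signed_takagi_on_segment:
  assumes "sign_sequence \<omega>" "0 \<le> t" "t \<le> 1"
  shows "signed_takagi \<omega> ((real i + t) / 4 ^ n)
           = 2 / 4 ^ n * ((1 - t) * of_int (vertex \<omega> n i) + t * of_int (vertex \<omega> n (i + 1)))
             + signed_takagi (\<lambda>k. \<omega> (2 * n + k)) t / 4 ^ n"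
  using assms(2,3)
proof (induction n arbitrary: i t)
  case 0
  then show ?case using signed_takagi_periodic[of \<omega> t i] by (simp add: add.commute)
next
  case (Suc n)
  define j r s where "j = i div 4" and "r = i mod 4" and "s = (real r + t) / 4"
  define p q where "p = \<lfloor>\<omega> (2 * n)\<rfloor>" and "q = \<lfloor>\<omega> (2 * n + 1)\<rfloor>"
  have i: "i = 4 * j + r" and r: "r < 4" by (simp_all add: j_def r_def)
  define u w where "u = vertex \<omega> n j" and "w = vertex \<omega> n (j + 1)"
  have s: "0 \<le> s" "s \<le> 1" using r Suc.prems by (auto simp: s_def)
  have pq: "p \<in> {-1, 1}" "q \<in> {-1, 1}" "of_int p = \<omega> (2 * n)" "of_int q = \<omega> (2 * n + 1)"
    using sign_floor[OF assms(1)] by (auto simp: p_def q_def)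
  have s4: "4 * s = real r + t" by (simp add: s_def)
  have tail: "signed_takagi (\<lambda>k. \<omega> (2 * n + k)) s =
      of_int p * dist_int s + of_int q / 2 * dist_int (2 * s)
        + signed_takagi (\<lambda>k. \<omega> (2 * Suc n + k)) t / 4"
    using signed_takagi_two_steps[OF sign_sequence_shift[OF assms(1), of "2 * n"], of s]
      signed_takagi_periodic[of "\<lambda>k. \<omega> (2 * Suc n + k)" t r]
    by (simp add: pq s4 add_ac)
  have "(real i + t) / 4 ^ Suc n = (real j + s) / 4 ^ n" by (simp add: i s_def field_simps)
  then have "signed_takagi \<omega> ((real i + t) / 4 ^ Suc n)
      = 2 / 4 ^ n * ((1 - s) * of_int u + s * of_int w) + signed_takagi (\<lambda>k. \<omega> (2 * n + k)) s / 4 ^ n"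
    using Suc.IH[OF s, of j] by (simp add: u_def w_def)
  also have "\<dots> = 2 / 4 ^ Suc n * (4 * ((1 - s) * of_int u + s * of_int w)
        + (1 - t) * of_int (bump p q r) + t * of_int (bump p q (r + 1)))
      + signed_takagi (\<lambda>k. \<omega> (2 * Suc n + k)) t / 4 ^ Suc n"
    unfolding tail bump_interpolates[OF pq(1,2) r Suc.prems s4]
    by (simp add: field_simps)
  also have "4 * ((1 - s) * of_int u + s * of_int w)
        + (1 - t) * of_int (bump p q r) + t * of_int (bump p q (r + 1))
      = (1 - t) * real_of_int (refine p q u w r) + t * real_of_int (refine p q u w (r + 1))"
    by (simp add: refine_def s_def field_simps)
  also have "refine p q u w r = vertex \<omega> (Suc n) i"
    using vertex_refine[of r \<omega> n j] r by (simp only: i p_def q_def u_def w_def)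
  also have "refine p q u w (r + 1) = vertex \<omega> (Suc n) (i + 1)"
    using vertex_refine[of "r + 1" \<omega> n j] r
    by (simp only: i p_def q_def u_def w_def add.assoc)
  finally show ?case .
qed

section \<open>Upper bound\<close>

text \<open>
  The line is cut into strips \<open>[j, j + 1]\<close> of integer height. A segment from \<open>u\<close> to \<open>w\<close> either runs
  across the strips between its ends or is flat.
\<close>

definition crosses :: "int \<Rightarrow> int \<Rightarrow> int \<Rightarrow> bool" where
  "crosses u w j \<longleftrightarrow> min u w \<le> j \<and> j < max u w"

definition flat :: "int \<Rightarrow> int \<Rightarrow> int \<Rightarrow> bool" where
  "flat u w j \<longleftrightarrow> u = j \<and> w = j"

lemma sum_over_pairs:
  "(\<Sum>r<4. F (refine p q u w r) (refine p q u w (r + 1)))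
     = F (refine p q u w 0) (refine p q u w 1) + F (refine p q u w 1) (refine p q u w 2)
       + F (refine p q u w 2) (refine p q u w 3) + (F (refine p q u w 3) (refine p q u w 4) :: nat)"
  by (simp add: eval_nat_numeral)

lemma refine_values:
  "refine p q u w 0 = 4 * u"
  "refine p q u w 1 = 4 * u + (w - u) + (p + q) div 2"
  "refine p q u w 2 = 4 * u + 2 * (w - u) + p"
  "refine p q u w 3 = 4 * u + 3 * (w - u) + (p + q) div 2"
  "refine p q u w 4 = 4 * w"
  by (simp_all add: refine_def bump_def)

lemma crosses_4_iff: "crosses (4 * u) (4 * w) J \<longleftrightarrow> crosses u w (J div 4)"
  unfolding crosses_def min_def max_def by presburger

lemma bump_step:
  assumes "p \<in> {-1, 1}" "q \<in> {-1, 1}"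
  shows "\<bar>bump p q (Suc r) - bump p q r\<bar> \<le> 1"
proof -
  consider "r = 0" | "r = 1" | "r = 2" | "r = 3" | "r > 3" by linarith
  then show ?thesis by cases (use assms in \<open>auto simp: bump_def\<close>)
qed

lemma refine_step: "refine p q u w (Suc r) - refine p q u w r = w - u + (bump p q (Suc r) - bump p q r)"
  by (simp add: refine_def algebra_simps)

lemma crosses_monotone_chain:
  assumes "\<And>r. r < n \<Longrightarrow> g r \<le> g (Suc r)"
  shows "(\<Sum>r<n. of_bool (crosses (g r) (g (r + 1)) J)) = (of_bool (crosses (g 0) (g n) J) :: nat)"
proof -
  have "(\<Sum>r<n. of_bool (crosses (g r) (g (r + 1)) J)) = (of_bool (crosses (g 0) (g n) J) :: nat) \<and> g 0 \<le> g n"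
    using assms
  proof (induction n)
    case (Suc n)
    then have "g n \<le> g (Suc n)" and IH: "g 0 \<le> g n"
      "(\<Sum>r<n. of_bool (crosses (g r) (g (r + 1)) J)) = (of_bool (crosses (g 0) (g n) J) :: nat)"
      by auto
    then show ?case unfolding sum.lessThan_Suc IH(2) by (auto simp: crosses_def)
  qed (simp add: crosses_def)
  then show ?thesis ..
qed

text \<open>
  Strip \<open>J\<close> of the finer grid lies in strip \<open>J div 4\<close> of the coarser one. A segment that is not flat is
  refined to a monotone polygon, because its slope is at least 1 and is changed by at most 1; so it
  crosses \<open>J\<close> exactly once if it crossed the coarse strip. A flat segment grows a single bump of height 1,
  which is crossed on its way up and down; it reaches \<open>J\<close> only if its height is \<open>J\<close> or \<open>J + 1\<close>, rounded as in \<open>(J + 3) div 4\<close>.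
\<close>

lemma crosses_refine:
  assumes pq: "p \<in> {-1, 1}" "q \<in> {-1, 1}"
  shows "(\<Sum>r<4. of_bool (crosses (refine p q u w r) (refine p q u w (r + 1)) J))
           \<le> of_bool (crosses u w (J div 4)) + 2 * (of_bool (flat u w ((J + 3) div 4)) :: nat)"
proof -
  let ?g = "refine p q u w"
  have ends: "?g 0 = 4 * u" "?g 4 = 4 * w" by (simp_all add: refine_values)
  have step: "\<bar>?g (Suc r) - ?g r - (w - u)\<bar> \<le> 1" for r
    using bump_step[OF pq, of r] by (simp add: refine_step)
  consider "u < w" | "w < u" | "u = w" by linarith
  then show ?thesis
  proof cases
    case 1
    have "?g r \<le> ?g (Suc r)" for r using step[of r] 1 by linarith
    then have "(\<Sum>r<4. of_bool (crosses (?g r) (?g (r + 1)) J)) = (of_bool (crosses (?g 0) (?g 4) J) :: nat)"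
      by (intro crosses_monotone_chain)
    then show ?thesis by (simp add: ends crosses_4_iff)
  next
    case 2
    \<comment> \<open>reflection maps strip \<open>J\<close> to strip \<open>- J - 1\<close>\<close>
    have "- ?g r \<le> - ?g (Suc r)" for r using step[of r] 2 by linarith
    then have "(\<Sum>r<4. of_bool (crosses (- ?g r) (- ?g (r + 1)) (- J - 1)))
        = (of_bool (crosses (- ?g 0) (- ?g 4) (- J - 1)) :: nat)"
      by (intro crosses_monotone_chain)
    moreover have "crosses (- a) (- b) (- J - 1) \<longleftrightarrow> crosses a b J" for a b
      by (auto simp: crosses_def)
    ultimately show ?thesis by (simp add: ends crosses_4_iff)
  next
    case 3
    have le: "of_bool (crosses (4 * w) (4 * w + a) J) \<le> (of_bool (flat w w ((J + 3) div 4)) :: nat)"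
      and le': "of_bool (crosses (4 * w + a) (4 * w) J) \<le> (of_bool (flat w w ((J + 3) div 4)) :: nat)"
      if "a \<in> {-1, 1}" for a
    proof -
      have "(J + 3) div 4 = w" if "crosses (4 * w) (4 * w + a) J \<or> crosses (4 * w + a) (4 * w) J"
        using that \<open>a \<in> {-1, 1}\<close> unfolding crosses_def min_def max_def insert_iff empty_iff
        by presburger
      then show "of_bool (crosses (4 * w) (4 * w + a) J) \<le> (of_bool (flat w w ((J + 3) div 4)) :: nat)"
        "of_bool (crosses (4 * w + a) (4 * w) J) \<le> (of_bool (flat w w ((J + 3) div 4)) :: nat)"
        by (auto simp: flat_def)
    qed
    have [simp]: "\<not> crosses a a J" for a by (simp add: crosses_def)
    consider "q = p" | "q = - p" using pq by auto
    then show ?thesis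
      unfolding 3 sum_over_pairs[of "\<lambda>a b. of_bool (crosses a b J)"]
      unfolding refine_values by cases (use pq le[of p] le'[of p] in simp_all)
  qed
qed

text \<open>
  A quarter is flat when the bump cancels the slope. For a flat segment this happens on two of the four
  quarters, at a common height. For slope \<open>\<plusminus>1\<close> it happens on a single quarter, at distance
  \<open>\<bar>q - p\<bar> / 2\<close> from the upper end of the segment if \<open>p = 1\<close> and from the lower end if \<open>p = -1\<close>.
\<close>

lemma flat_children:
  assumes pq: "p \<in> {-1, 1}" "q \<in> {-1, 1}"
  shows "(\<Sum>r<4. of_bool (flat (refine p q u w r) (refine p q u w (r + 1)) J))
           = 2 * of_bool (w = u \<and> 4 * u + (p + q) div 2 = J)
             + of_bool (w = u - p \<and> 4 * u + (q - p) div 2 = J)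
             + (of_bool (w = u + p \<and> 4 * w + (q - p) div 2 = J) :: nat)"
proof -
  define c where "c = (p + q) div 2"
  have pairs:
    "flat (4 * u) (4 * u + (w - u) + c) J \<longleftrightarrow> w = u - c \<and> 4 * u = J"
    "flat (4 * u + (w - u) + c) (4 * u + 2 * (w - u) + p) J \<longleftrightarrow> w = u + c - p \<and> 4 * u + 2 * c - p = J"
    "flat (4 * u + 2 * (w - u) + p) (4 * u + 3 * (w - u) + c) J \<longleftrightarrow> w = u + p - c \<and> 4 * w - p + 2 * c = J"
    "flat (4 * u + 3 * (w - u) + c) (4 * w) J \<longleftrightarrow> w = u + c \<and> 4 * w = J"
    unfolding flat_def by presburger+
  have "(\<Sum>r<4. of_bool (flat (refine p q u w r) (refine p q u w (r + 1)) J))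
      = of_bool (w = u - c \<and> 4 * u = J) + of_bool (w = u + c - p \<and> 4 * u + 2 * c - p = J)
        + of_bool (w = u + p - c \<and> 4 * w - p + 2 * c = J) + (of_bool (w = u + c \<and> 4 * w = J) :: nat)"
    unfolding sum_over_pairs[of "\<lambda>a b. of_bool (flat a b J)"]
    unfolding refine_values c_def[symmetric] pairs ..
  also have "\<dots> = 2 * of_bool (w = u \<and> 4 * u + c = J) + of_bool (w = u - p \<and> 4 * u + (q - p) div 2 = J)
             + of_bool (w = u + p \<and> 4 * w + (q - p) div 2 = J)"
  proof -
    consider (same) "c = p" "(q - p) div 2 = 0" | (opposite) "c = 0" "(q - p) div 2 = - p"
      using pq by (auto simp: c_def)
    then show ?thesis
    proof cases
      case same
      have "w = u + p - p \<and> 4 * u + 2 * p - p = J \<longleftrightarrow> w = u \<and> 4 * u + p = J"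
        "w = u + p - p \<and> 4 * w - p + 2 * p = J \<longleftrightarrow> w = u \<and> 4 * u + p = J"
        by presburger+
      then show ?thesis unfolding same by simp
    next
      case opposite
      have "w = u - 0 \<and> 4 * u = J \<longleftrightarrow> w = u \<and> 4 * u + 0 = J"
        "w = u + 0 \<and> 4 * w = J \<longleftrightarrow> w = u \<and> 4 * u + 0 = J"
        "w = u + 0 - p \<and> 4 * u + 2 * 0 - p = J \<longleftrightarrow> w = u - p \<and> 4 * u + - p = J"
        "w = u + p - 0 \<and> 4 * w - p + 2 * 0 = J \<longleftrightarrow> w = u + p \<and> 4 * w + - p = J"
        by presburger+
      then show ?thesis unfolding opposite by simp
    qed
  qed
  finally show ?thesis unfolding c_def .
qed

text \<open>
  Modulo 4, the heights of flat pieces that come from flat segments differ by \<open>p\<close> from those that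
  come from segments of slope \<open>\<plusminus>1\<close>. Hence at a given height only one of the two sources can contribute, and
  there it has only one coarse height, or one coarse strip, to draw from.
\<close>

lemma flat_refine:
  assumes pq: "p \<in> {-1, 1}" "q \<in> {-1, 1}"
  shows "(\<exists>v. \<forall>u w. (\<Sum>r<4. of_bool (flat (refine p q u w r) (refine p q u w (r + 1)) J))
               \<le> 2 * (of_bool (flat u w v) :: nat)) \<or>
         (\<exists>j. \<forall>u w. (\<Sum>r<4. of_bool (flat (refine p q u w r) (refine p q u w (r + 1)) J))
               \<le> (of_bool (crosses u w j) :: nat))"
proof -
  define c e where "c = (p + q) div 2" and "e = (q - p) div 2"
  \<comment> \<open>flat pieces have heights in \<open>c + 4\<int>\<close> or in \<open>e + 4\<int>\<close>, according to their origin\<close>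
  have ce: "c - e = p" using pq by (auto simp: c_def e_def)
  show ?thesis
  proof (cases "4 dvd J - c")
    case True
    then obtain v where v: "J = 4 * v + c" by (metis dvdE diff_add_cancel)
    have "4 * x + e \<noteq> J" for x
    proof
      assume "4 * x + e = J"
      then have "p = 4 * (x - v)" using v ce by simp
      then show False using pq unfolding insert_iff empty_iff by presburger
    qed
    then show ?thesis
      unfolding flat_children[OF pq] c_def[symmetric] e_def[symmetric]
      by (intro disjI1 exI[of _ v]) (simp add: flat_def v)
  next
    case False
    then have "4 * x + c \<noteq> J" for x by auto
    \<comment> \<open>such a segment has its upper end (if \<open>p = 1\<close>) or lower end (if \<open>p = -1\<close>) at \<open>(J - e) / 4\<close>\<close>
    moreover have "of_bool (w = u - p \<and> 4 * u + e = J) + of_bool (w = u + p \<and> 4 * w + e = J)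
        \<le> (of_bool (crosses u w ((J - e) div 4 - (p + 1) div 2)) :: nat)" for u w
      using pq by (auto simp: crosses_def)
    ultimately show ?thesis
      unfolding flat_children[OF pq] c_def[symmetric] e_def[symmetric]
      by (intro disjI2 exI[of _ "(J - e) div 4 - (p + 1) div 2"]) simp
  qed
qed

definition crossing_count :: "(nat \<Rightarrow> real) \<Rightarrow> nat \<Rightarrow> int \<Rightarrow> nat" where
  "crossing_count \<omega> n j = (\<Sum>i<4 ^ n. of_bool (crosses (vertex \<omega> n i) (vertex \<omega> n (i + 1)) j))"

definition flat_count :: "(nat \<Rightarrow> real) \<Rightarrow> nat \<Rightarrow> int \<Rightarrow> nat" where
  "flat_count \<omega> n j = (\<Sum>i<4 ^ n. of_bool (flat (vertex \<omega> n i) (vertex \<omega> n (i + 1)) j))"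

lemma sum_over_children:
  "(\<Sum>i<4 ^ Suc n. F (vertex \<omega> (Suc n) i) (vertex \<omega> (Suc n) (i + 1)))
     = (\<Sum>i<4 ^ n. \<Sum>r<4. F (refine \<lfloor>\<omega> (2 * n)\<rfloor> \<lfloor>\<omega> (2 * n + 1)\<rfloor> (vertex \<omega> n i) (vertex \<omega> n (i + 1)) r)
         (refine \<lfloor>\<omega> (2 * n)\<rfloor> \<lfloor>\<omega> (2 * n + 1)\<rfloor> (vertex \<omega> n i) (vertex \<omega> n (i + 1)) (r + 1)))"
proof -
  have split: "(\<Sum>i<4 * N. g i) = (\<Sum>i<N. \<Sum>r<4. g (4 * i + r))" for N and g :: "nat \<Rightarrow> 'a"
    by (induction N) (simp_all add: eval_nat_numeral add_ac)
  have "(\<Sum>i<4 ^ Suc n. F (vertex \<omega> (Suc n) i) (vertex \<omega> (Suc n) (i + 1)))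
      = (\<Sum>i<4 ^ n. \<Sum>r<4. F (vertex \<omega> (Suc n) (4 * i + r)) (vertex \<omega> (Suc n) (4 * i + (r + 1))))"
    unfolding power_Suc by (simp only: split add.assoc)
  also have "\<dots> = (\<Sum>i<4 ^ n. \<Sum>r<4. F (refine \<lfloor>\<omega> (2 * n)\<rfloor> \<lfloor>\<omega> (2 * n + 1)\<rfloor> (vertex \<omega> n i) (vertex \<omega> n (i + 1)) r)
         (refine \<lfloor>\<omega> (2 * n)\<rfloor> \<lfloor>\<omega> (2 * n + 1)\<rfloor> (vertex \<omega> n i) (vertex \<omega> n (i + 1)) (r + 1)))"
    by (intro sum.cong refl) (simp add: vertex_refine del: vertex.simps add_Suc_right)
  finally show ?thesis .
qed

text \<open>
  By the two preceding estimates the counts \<open>c\<close> and \<open>h\<close> of crossing and flat segments satisfy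
  \<open>c' \<le> c + 2 h\<close> and \<open>h' \<le> max (2 h) c\<close>, starting from \<open>c = 0\<close> and \<open>h = 1\<close>. The bounds
  \<open>c \<le> 2 \<cdot> 2\<^sup>n\<close> and \<open>h \<le> 2\<^sup>n\<close> reproduce themselves under this recursion.
\<close>

lemma count_bounds:
  assumes "sign_sequence \<omega>"
  shows "crossing_count \<omega> n J \<le> 2 * 2 ^ n \<and> flat_count \<omega> n J \<le> 2 ^ n"
proof (induction n arbitrary: J)
  case 0
  show ?case by (simp add: crossing_count_def flat_count_def crosses_def)
next
  case (Suc n)
  define p q where "p = \<lfloor>\<omega> (2 * n)\<rfloor>" and "q = \<lfloor>\<omega> (2 * n + 1)\<rfloor>"
  have pq: "p \<in> {-1, 1}" "q \<in> {-1, 1}" using sign_floor[OF assms] by (simp_all add: p_def q_def)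
  have "crossing_count \<omega> (Suc n) J
      \<le> crossing_count \<omega> n (J div 4) + 2 * flat_count \<omega> n ((J + 3) div 4)"
    unfolding crossing_count_def flat_count_def p_def[symmetric] q_def[symmetric]
      sum_over_children[of "\<lambda>u w. of_bool (crosses u w J)"] sum_distrib_left sum.distrib[symmetric]
    by (intro sum_mono crosses_refine pq)
  then have "crossing_count \<omega> (Suc n) J \<le> 2 * 2 ^ Suc n"
    using Suc.IH[of "J div 4"] Suc.IH[of "(J + 3) div 4"] by simp
  moreover from flat_refine[OF pq, of J]
  have "(\<exists>v. flat_count \<omega> (Suc n) J \<le> 2 * flat_count \<omega> n v) \<or>
        (\<exists>j. flat_count \<omega> (Suc n) J \<le> crossing_count \<omega> n j)"
    unfolding crossing_count_def flat_count_def p_def[symmetric] q_def[symmetric]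
      sum_over_children[of "\<lambda>u w. of_bool (flat u w J)"] sum_distrib_left
    by (elim disj_forward ex_forward; intro sum_mono; blast)
  then have "flat_count \<omega> (Suc n) J \<le> 2 ^ Suc n"
    using Suc.IH by (auto intro: order_trans)
  ultimately show ?case ..
qed

lemma quaternary_interval:
  assumes "0 \<le> x" "x \<le> 1"
  obtains i t where "i < 4 ^ n" "0 \<le> t" "t \<le> 1" "x = (real i + t) / 4 ^ n"
proof (cases "x = 1")
  case True
  show thesis by (rule that[of "4 ^ n - 1" 1]) (auto simp: True of_nat_diff)
next
  case False
  define i where "i = nat \<lfloor>4 ^ n * x\<rfloor>"
  have i: "real i = of_int \<lfloor>4 ^ n * x\<rfloor>" using assms by (simp add: i_def)
  have "real i < 4 ^ n" using False assms unfolding i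
    by (intro le_less_trans[OF of_int_floor_le]) simp
  moreover have "0 \<le> 4 ^ n * x - real i" "4 ^ n * x - real i \<le> 1" unfolding i by linarith+
  moreover have "x = (real i + (4 ^ n * x - real i)) / 4 ^ n" by simp
  ultimately show thesis using that by (metis of_nat_less_iff of_nat_numeral of_nat_power)
qed

text \<open>
  The copy that rides on a segment deviates from it by at most half a strip height, so a segment that
  meets the level has to cross, or be flat at, one of the three strips around that level; each of these accounts for at most
  \<open>2 \<cdot> 2\<^sup>n + 2\<^sup>n\<close> segments.
\<close>

lemma card_segments_meeting_level_set:
  assumes \<omega>: "sign_sequence \<omega>"
  shows "card {i. i < 4 ^ n \<and> (\<exists>t\<in>{0..1}. signed_takagi \<omega> ((real i + t) / 4 ^ n) = y)} \<le> 9 * 2 ^ n"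
    (is "card ?S \<le> _")
proof -
  define S where "S = ?S"
  define J where "J = \<lfloor>4 ^ n * y / 2\<rfloor>"
  let ?c = "\<lambda>j i. crosses (vertex \<omega> n i) (vertex \<omega> n (i + 1)) j"
  let ?f = "\<lambda>j i. flat (vertex \<omega> n i) (vertex \<omega> n (i + 1)) j"
  have near: "\<exists>j\<in>{J - 1, J, J + 1}. ?c j i \<or> ?f j i" if i: "i \<in> S" for i
  proof -
    obtain t where t: "0 \<le> t" "t \<le> 1" "signed_takagi \<omega> ((real i + t) / 4 ^ n) = y"
      using i by (auto simp: S_def)
    define u w where "u = vertex \<omega> n i" and "w = vertex \<omega> n (i + 1)"
    define h where "h = (1 - t) * real_of_int u + t * real_of_int w"
    have "y = 2 / 4 ^ n * h + signed_takagi (\<lambda>k. \<omega> (2 * n + k)) t / 4 ^ n"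
      using signed_takagi_on_segment[OF \<omega> t(1,2), of i n] t(3) by (simp add: h_def u_def w_def)
    then have "4 ^ n * y / 2 = h + signed_takagi (\<lambda>k. \<omega> (2 * n + k)) t / 2"
      by (simp add: field_simps)
    moreover have "\<bar>signed_takagi (\<lambda>k. \<omega> (2 * n + k)) t\<bar> \<le> 1"
      by (intro signed_takagi_abs_le_1 sign_sequence_shift \<omega>)
    ultimately have hJ: "of_int J - 1 / 2 \<le> h" "h < of_int J + 3 / 2"
      unfolding J_def by linarith+
    have "min u w \<le> h" "h \<le> max u w"
      using t convex_bound_le[of "u" "max u w" w "1 - t" t] convex_bound_le[of "- real_of_int u" "- min u w" "- real_of_int w" "1 - t" t]
      by (auto simp: h_def)
    then have "min u w \<le> J + 1" "J \<le> max u w" using hJ by linarith+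
    then have "\<exists>j\<in>{J - 1, J, J + 1}. crosses u w j \<or> flat u w j"
      unfolding crosses_def flat_def bex_simps insert_iff min_def max_def by (auto split: if_splits)
    then show ?thesis by (simp add: u_def w_def)
  qed
  have "card (S) = (\<Sum>i<4 ^ n. of_bool (i \<in> S))"
    by (subst sum_of_bool_eq) (auto simp: S_def intro!: arg_cong[where f = card])
  also have "\<dots> \<le> (\<Sum>i<4 ^ n. \<Sum>j\<in>{J - 1, J, J + 1}. of_bool (?c j i) + of_bool (?f j i))"
    using near by (intro sum_mono) (auto simp: of_bool_def)
  also have "\<dots> = (\<Sum>j\<in>{J - 1, J, J + 1}. crossing_count \<omega> n j + flat_count \<omega> n j)"
    unfolding crossing_count_def flat_count_def sum.distrib[symmetric] by (rule sum.swap)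
  also have "\<dots> \<le> (\<Sum>j\<in>{J - 1, J, J + 1}. 2 * 2 ^ n + 2 ^ n)"
    using count_bounds[OF \<omega>] by (intro sum_mono add_mono) blast+
  also have "\<dots> = 9 * 2 ^ n" by simp
  finally show ?thesis by (simp add: S_def)
qed

lemma level_set_dim_le_half:
  assumes \<omega>: "sign_sequence \<omega>"
  shows "hausdorff_dim (level_set (signed_takagi \<omega>) y) \<le> ereal (1/2)"
proof (rule hausdorff_dim_le_box_counting[where \<rho> = "\<lambda>n. (1/4) ^ n" and C = 9])
  show "(\<lambda>n. (1/4) ^ n :: real) \<longlonglongrightarrow> 0" by (intro LIMSEQ_realpow_zero) auto
  fix n
  define S where "S = {i. i < 4 ^ n \<and> (\<exists>t\<in>{0..1}. signed_takagi \<omega> ((real i + t) / 4 ^ n) = y)}"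
  define I where "I i = {real i / 4 ^ n .. (real i + 1) / 4 ^ n}" for i
  have S: "finite S" "card S \<le> 9 * 2 ^ n" using card_segments_meeting_level_set[OF \<omega>] by (simp_all add: S_def)
  have "card (I ` S) \<le> 9 * 2 ^ n" using card_image_le[OF S(1), of I] S(2) by linarith
  then have "real (card (I ` S)) \<le> real (9 * 2 ^ n)" by (simp only: of_nat_le_iff)
  then have "real (card (I ` S)) \<le> 9 * 2 ^ n" by simp
  also have "(2::real) ^ n = ((1/4) ^ n) powr - (1/2)"
    by (simp add: powr_minus powr_half_sqrt real_sqrt_divide real_sqrt_power power_one_over)
  finally have "real (card (I ` S)) \<le> 9 * ((1/4) ^ n) powr - (1/2)" .
  moreover have "level_set (signed_takagi \<omega>) y \<subseteq> \<Union> (I ` S)"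
  proof
    fix x assume "x \<in> level_set (signed_takagi \<omega>) y"
    then have x: "0 \<le> x" "x \<le> 1" "signed_takagi \<omega> x = y" by (auto simp: level_set_def)
    obtain i t where "i < 4 ^ n" "0 \<le> t" "t \<le> 1" "x = (real i + t) / 4 ^ n"
      by (rule quaternary_interval[OF x(1,2)])
    then have "i \<in> S" "x \<in> I i" using x(3) by (auto simp: S_def I_def divide_right_mono)
    then show "x \<in> \<Union> (I ` S)" by blast
  qed
  moreover have "bounded U \<and> diameter U \<le> (1/4) ^ n" if "U \<in> I ` S" for U
    using that by (auto simp: I_def add_divide_distrib power_one_over)
  ultimately show "\<exists>F. finite F \<and> real (card F) \<le> 9 * ((1/4) ^ n) powr - (1/2) \<and>
      level_set (signed_takagi \<omega>) y \<subseteq> \<Union>F \<and> (\<forall>U\<in>F. bounded U \<and> diameter U \<le> (1/4) ^ n)"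
    using S(1) by (intro exI[of _ "I ` S"]) blast
qed auto

section \<open>A Cantor set of half dimension\<close>

text \<open>
  The two flat quarters of a flat segment: the middle ones if the two signs agree, and the
  outer ones if they differ.
\<close>

definition flat_digit :: "(nat \<Rightarrow> real) \<Rightarrow> nat \<Rightarrow> nat \<Rightarrow> nat" where
  "flat_digit \<omega> n b = (if \<omega> (2 * n) = \<omega> (2 * n + 1) then if b = 0 then 1 else 2
                       else if b = 0 then 0 else 3)"

text \<open>
  Here \<open>k < 2\<^sup>n\<close> is read as a word of \<open>n\<close> binary digits, which select one of the two flat quarters
  at each step; \<open>cantor_level \<omega> n\<close> below is the height of the flat segments reached, which does not depend on the
  choices.
\<close>

fun cantor_index :: "(nat \<Rightarrow> real) \<Rightarrow> nat \<Rightarrow> nat \<Rightarrow> nat" where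
  "cantor_index \<omega> 0 k = 0"
| "cantor_index \<omega> (Suc n) k = 4 * cantor_index \<omega> n (k div 2) + flat_digit \<omega> n (k mod 2)"

fun cantor_level :: "(nat \<Rightarrow> real) \<Rightarrow> nat \<Rightarrow> int" where
  "cantor_level \<omega> 0 = 0"
| "cantor_level \<omega> (Suc n) = 4 * cantor_level \<omega> n + (\<lfloor>\<omega> (2 * n)\<rfloor> + \<lfloor>\<omega> (2 * n + 1)\<rfloor>) div 2"

lemma flat_digit_le_3: "flat_digit \<omega> n b \<le> 3"
  by (simp add: flat_digit_def)

lemma refine_flat_digit:
  assumes "sign_sequence \<omega>" and p: "p = \<lfloor>\<omega> (2 * n)\<rfloor>" and q: "q = \<lfloor>\<omega> (2 * n + 1)\<rfloor>"
  shows "refine p q u u (flat_digit \<omega> n b) = 4 * u + (p + q) div 2"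
    and "refine p q u u (flat_digit \<omega> n b + 1) = 4 * u + (p + q) div 2"
proof -
  have pq: "p \<in> {-1, 1}" "q \<in> {-1, 1}" using sign_floor(1)[OF assms(1)] by (simp_all only: p q)
  have "p = q \<longleftrightarrow> \<omega> (2 * n) = \<omega> (2 * n + 1)"
    unfolding p q using sign_floor(2)[OF assms(1)] by metis
  then have "flat_digit \<omega> n b = (if p = q then if b = 0 then 1 else 2 else if b = 0 then 0 else 3)"
    by (simp add: flat_digit_def)
  then show "refine p q u u (flat_digit \<omega> n b) = 4 * u + (p + q) div 2"
    and "refine p q u u (flat_digit \<omega> n b + 1) = 4 * u + (p + q) div 2"
    using pq by (auto simp: refine_def bump_def)
qed

lemma vertex_cantor_index:
  assumes "sign_sequence \<omega>"
  shows "vertex \<omega> n (cantor_index \<omega> n k) = cantor_level \<omega> n \<and>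
         vertex \<omega> n (cantor_index \<omega> n k + 1) = cantor_level \<omega> n"
proof (induction n arbitrary: k)
  case (Suc n)
  define d where "d = flat_digit \<omega> n (k mod 2)"
  have d: "d \<le> 4" "d + 1 \<le> 4" using flat_digit_le_3[of \<omega> n "k mod 2"] by (simp_all add: d_def)
  have "vertex \<omega> (Suc n) (4 * cantor_index \<omega> n (k div 2) + d) = cantor_level \<omega> (Suc n)"
    "vertex \<omega> (Suc n) (4 * cantor_index \<omega> n (k div 2) + (d + 1)) = cantor_level \<omega> (Suc n)"
    unfolding vertex_refine[OF d(1)] vertex_refine[OF d(2)]
    using Suc.IH[of "k div 2"] refine_flat_digit[OF assms refl refl, of n "cantor_level \<omega> n" "k mod 2"]
    by (simp_all only: d_def cantor_level.simps)
  then show ?case by (simp add: d_def add.assoc del: vertex.simps)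
qed simp

lemma cantor_index_strict_mono:
  "k < k' \<Longrightarrow> k' < 2 ^ n \<Longrightarrow> cantor_index \<omega> n k < cantor_index \<omega> n k'"
proof (induction n arbitrary: k k')
  case (Suc n)
  have d: "flat_digit \<omega> n (k mod 2) \<le> 3" "flat_digit \<omega> n (k' mod 2) \<le> 3"
    by (rule flat_digit_le_3)+
  have k2: "k' div 2 < 2 ^ n" using Suc.prems by auto
  show ?case
  proof (cases "k div 2 < k' div 2")
    case True
    then have "cantor_index \<omega> n (k div 2) < cantor_index \<omega> n (k' div 2)" using Suc.IH k2 by blast
    then show ?thesis using d by simp
  next
    case False
    then have same: "k' div 2 = k div 2" and "k mod 2 = 0" "k' mod 2 = 1"
      using Suc.prems(1) by presburger+
    then show ?thesis unfolding cantor_index.simps by (simp add: flat_digit_def)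
  qed
qed simp

lemma cantor_height:
  assumes "sign_sequence \<omega>"
  shows "(\<lambda>n. 2 / 4 ^ n * real_of_int (cantor_level \<omega> n))
           \<longlonglongrightarrow> (\<Sum>n. (\<omega> (2 * n) + \<omega> (2 * n + 1)) / 4 ^ (n + 1))"
proof -
  have level: "2 / 4 ^ n * real_of_int (cantor_level \<omega> n) = (\<Sum>m<n. (\<omega> (2 * m) + \<omega> (2 * m + 1)) / 4 ^ (m + 1))" for n
  proof (induction n)
    case (Suc n)
    define p q where "p = \<lfloor>\<omega> (2 * n)\<rfloor>" and "q = \<lfloor>\<omega> (2 * n + 1)\<rfloor>"
    have pq: "p \<in> {-1, 1}" "q \<in> {-1, 1}" "of_int p = \<omega> (2 * n)" "of_int q = \<omega> (2 * n + 1)"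
      using sign_floor[OF assms] by (simp_all add: p_def q_def)
    have "even (p + q)" using pq(1,2) by auto
    then have "2 * real_of_int ((p + q) div 2) = \<omega> (2 * n) + \<omega> (2 * n + 1)"
      using pq(3,4) by (metis dvd_mult_div_cancel of_int_add of_int_mult of_int_numeral)
    moreover have "2 / 4 ^ Suc n * real_of_int (4 * cantor_level \<omega> n + (p + q) div 2)
        = 2 / 4 ^ n * real_of_int (cantor_level \<omega> n) + 2 * real_of_int ((p + q) div 2) / 4 ^ (n + 1)"
      by (simp add: field_simps)
    ultimately show ?case
      unfolding cantor_level.simps p_def[symmetric] q_def[symmetric] sum.lessThan_Suc Suc.IH[symmetric] by simp
  qed simp
  have bound: "norm ((\<omega> (2 * m) + \<omega> (2 * m + 1)) / 4 ^ (m + 1)) \<le> 2 * (1 / 4) ^ m" for m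
  proof -
    have "\<bar>\<omega> i\<bar> \<le> 1" for i
    proof -
      have "\<omega> i \<in> {-1, 1}" using assms unfolding sign_sequence_def by blast
      then show ?thesis by auto
    qed
    then have "\<bar>\<omega> (2 * m) + \<omega> (2 * m + 1)\<bar> \<le> 2"
      using abs_triangle_ineq[of "\<omega> (2 * m)" "\<omega> (2 * m + 1)"] by (smt (verit))
    then have "\<bar>\<omega> (2 * m) + \<omega> (2 * m + 1)\<bar> / 4 ^ (m + 1) \<le> 2 / 4 ^ m"
      by (intro frac_le) auto
    then show ?thesis by (simp add: power_one_over)
  qed
  have "summable (\<lambda>m. (\<omega> (2 * m) + \<omega> (2 * m + 1)) / 4 ^ (m + 1))"
    by (rule summable_comparison_test'[OF _ bound]) (intro summable_mult summable_geometric, simp)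
  then show ?thesis
    unfolding level by (rule summable_LIMSEQ)
qed

text \<open>
  The binary expansion of \<open>t\<close> selects a nested sequence of flat segments, and \<open>G t\<close> is their common point.
  If \<open>s\<close> and \<open>t\<close> are at least \<open>2 \<cdot> 2\<^sup>-\<^sup>n\<close> apart, then a full dyadic interval of order \<open>n\<close> lies between them,
  hence a full 4-adic interval of order \<open>n\<close> between \<open>G s\<close> and \<open>G t\<close>; a gap in the parameter
  is thus bounded by the square root of the gap in the image.
\<close>

lemma cantor_parametrisation:
  assumes \<omega>: "sign_sequence \<omega>"
  shows "\<exists>G. (\<forall>t\<in>{0..<1}. G t \<in> {0..1} \<and>
               signed_takagi \<omega> (G t) = (\<Sum>n. (\<omega> (2 * n) + \<omega> (2 * n + 1)) / 4 ^ (n + 1))) \<and>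
             (\<forall>s\<in>{0..<1}. \<forall>t\<in>{0..<1}. \<bar>s - t\<bar> \<le> 4 * dist (G s) (G t) powr (1/2))"
proof -
  define K where "K t n = nat \<lfloor>2 ^ n * t\<rfloor>" for t :: real and n
  define X where "X t n = real (cantor_index \<omega> n (K t n)) / 4 ^ n" for t n
  have "\<exists>x. \<forall>n. X t n \<le> x \<and> x \<le> X t n + 1 / 4 ^ n" if "t \<in> {0..<1}" for t
  proof -
    have K_Suc: "K t (Suc n) div 2 = K t n" for n
    proof -
      have "K t (Suc n) div 2 = nat (\<lfloor>2 * (2 ^ n * t)\<rfloor> div 2)"
        by (simp add: K_def nat_div_distrib mult_ac)
      also have "\<lfloor>2 * (2 ^ n * t)\<rfloor> div 2 = \<lfloor>2 ^ n * t\<rfloor>"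
        using floor_divide_real_eq_div[of 2 "2 * (2 ^ n * t)"] by simp
      finally show ?thesis by (simp add: K_def)
    qed
    have step: "X t n \<le> X t (Suc n)" "X t (Suc n) + 1 / 4 ^ Suc n \<le> X t n + 1 / 4 ^ n" for n
    proof -
      define d where "d = flat_digit \<omega> n (K t (Suc n) mod 2)"
      have "d \<le> 3" by (simp add: d_def flat_digit_le_3)
      have "X t (Suc n) = X t n + real d / 4 ^ Suc n"
        by (simp add: X_def K_Suc d_def field_simps)
      moreover have "real d / 4 ^ Suc n + 1 / 4 ^ Suc n \<le> 1 / 4 ^ n"
        using \<open>d \<le> 3\<close> by (simp add: field_simps)
      moreover have "0 \<le> real d / 4 ^ Suc n" by simp
      ultimately show "X t n \<le> X t (Suc n)" "X t (Suc n) + 1 / 4 ^ Suc n \<le> X t n + 1 / 4 ^ n"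
        by linarith+
    qed
    have "(\<lambda>n. X t n - (X t n + 1 / 4 ^ n)) \<longlonglongrightarrow> 0"
      using tendsto_minus[OF LIMSEQ_realpow_zero[of "1 / 4"]] by (simp add: power_one_over)
    then show ?thesis
      using nested_sequence_unique[of "X t" "\<lambda>n. X t n + 1 / 4 ^ n"] step by auto
  qed
  then have "\<forall>t. \<exists>x. t \<in> {0..<1} \<longrightarrow> (\<forall>n. X t n \<le> x \<and> x \<le> X t n + 1 / 4 ^ n)" by blast
  from choice[OF this] obtain G
    where G: "\<And>t n. t \<in> {0..<1} \<Longrightarrow> X t n \<le> G t \<and> G t \<le> X t n + 1 / 4 ^ n" by blast
  have "G t \<in> {0..1}" if t: "t \<in> {0..<1}" for t
    using G[OF t, of 0] by (simp add: X_def)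
  moreover have "signed_takagi \<omega> (G t) = (\<Sum>n. (\<omega> (2 * n) + \<omega> (2 * n + 1)) / 4 ^ (n + 1))" if t: "t \<in> {0..<1}" for t
  proof -
    let ?h = "\<lambda>n. 2 / 4 ^ n * real_of_int (cantor_level \<omega> n)"
    have bound: "\<bar>?h n - signed_takagi \<omega> (G t)\<bar> \<le> (1 / 4) ^ n" for n
    proof -
      define i s where "i = cantor_index \<omega> n (K t n)" and "s = 4 ^ n * G t - real i"
      have s: "0 \<le> s" "s \<le> 1" using G[OF t, of n] by (simp_all add: s_def X_def i_def field_simps)
      have v: "vertex \<omega> n i = cantor_level \<omega> n" "vertex \<omega> n (i + 1) = cantor_level \<omega> n"
        using vertex_cantor_index[OF \<omega>] unfolding i_def by blast+
      have "G t = (real i + s) / 4 ^ n" by (simp add: s_def)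
      then have "signed_takagi \<omega> (G t) = ?h n + signed_takagi (\<lambda>k. \<omega> (2 * n + k)) s / 4 ^ n"
        using signed_takagi_on_segment[OF \<omega> s, of i n] unfolding v by (simp add: algebra_simps)
      then have "\<bar>?h n - signed_takagi \<omega> (G t)\<bar> = \<bar>signed_takagi (\<lambda>k. \<omega> (2 * n + k)) s\<bar> / 4 ^ n"
        by simp
      also have "\<dots> \<le> 1 / 4 ^ n"
        by (intro divide_right_mono signed_takagi_abs_le_1 sign_sequence_shift \<omega>) simp
      finally show ?thesis by (simp add: power_one_over)
    qed
    have "(\<lambda>n. ?h n - signed_takagi \<omega> (G t)) \<longlonglongrightarrow> 0"
    proof (rule Lim_null_comparison)
      show "\<forall>\<^sub>F n in sequentially. norm (?h n - signed_takagi \<omega> (G t)) \<le> (1 / 4) ^ n"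
        using bound by (intro always_eventually allI) (simp only: real_norm_def)
      show "(\<lambda>n. (1 / 4 :: real) ^ n) \<longlonglongrightarrow> 0" by (rule LIMSEQ_realpow_zero) simp_all
    qed
    then have "?h \<longlonglongrightarrow> signed_takagi \<omega> (G t)" by (rule LIM_zero_cancel)
    then show ?thesis using cantor_height[OF \<omega>] LIMSEQ_unique by blast
  qed
  moreover have "\<bar>s - t\<bar> \<le> 4 * dist (G s) (G t) powr (1/2)" if "s \<in> {0..<1}" "t \<in> {0..<1}" for s t
  proof -
    have main: "t - s \<le> 4 * dist (G s) (G t) powr (1/2)" if st: "s \<in> {0..<1}" "t \<in> {0..<1}" "s < t" for s t
    proof -
      have "\<exists>n. (1 / 2) ^ n < (t - s) / 2" using st by (intro real_arch_pow_inv) auto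
      then obtain n0 where "(1 / 2) ^ n0 < (t - s) / 2" ..
      then have ex: "\<exists>n. 2 * (1 / 2) ^ n \<le> t - s" by (intro exI[of _ n0]) simp
      \<comment> \<open>the coarsest dyadic scale at which a full interval fits between the two parameters\<close>
      define n where "n = (LEAST n. 2 * (1 / 2) ^ n \<le> t - s)"
      have n: "2 * (1 / 2) ^ n \<le> t - s" unfolding n_def by (rule LeastI_ex[OF ex])
      have "n \<noteq> 0"
      proof
        assume "n = 0"
        then show False using n st by simp
      qed
      then obtain m where m: "n = Suc m" by (cases n) auto
      have "\<not> 2 * (1 / 2) ^ m \<le> t - s" using not_less_Least[of m "\<lambda>n. 2 * (1 / 2) ^ n \<le> t - s"] m by (simp add: n_def)
      then have upper: "t - s \<le> 4 * (1 / 2) ^ n" by (simp add: m)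
      have "2 ^ n * s + 2 \<le> 2 ^ n * t" using n by (simp add: field_simps power_one_over)
      then have K: "K s n + 2 \<le> K t n" unfolding K_def using st by (simp add: le_nat_iff le_floor_iff) linarith
      have "2 ^ n * t < 2 ^ n" using st by simp
      then have "K t n < 2 ^ n" unfolding K_def using st by (simp add: nat_less_iff floor_less_iff)
      then have "cantor_index \<omega> n (K s n) + 2 \<le> cantor_index \<omega> n (K t n)"
        using cantor_index_strict_mono[of "K s n" "K s n + 1" n \<omega>] cantor_index_strict_mono[of "K s n + 1" "K t n" n \<omega>] K
        by linarith
      then have "real (cantor_index \<omega> n (K s n)) + 2 \<le> real (cantor_index \<omega> n (K t n))" by linarith
      then have "X s n + 2 / 4 ^ n \<le> X t n"
        by (simp add: X_def add_divide_distrib[symmetric] divide_right_mono)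
      then have "1 / 4 ^ n \<le> dist (G s) (G t)"
        using G[OF st(1), of n] G[OF st(2), of n] by (simp add: dist_real_def)
      then have "(1 / 4 ^ n) powr (1/2) \<le> dist (G s) (G t) powr (1/2)" by (intro powr_mono2) auto
      moreover have "(1 / 4 ^ n) powr (1/2) = (1 / 2 :: real) ^ n"
        by (simp add: powr_half_sqrt real_sqrt_divide real_sqrt_power power_one_over)
      ultimately show ?thesis using upper by linarith
    qed
    show ?thesis
      using main[of s t] main[of t s] that by (cases s t rule: linorder_cases) (auto simp: dist_commute)
  qed
  ultimately show ?thesis by blast
qed

section \<open>Flat segments at all scales\<close>

text \<open>
  Among the four quarters of a segment both slope changes \<open>+1\<close> and \<open>-1\<close> occur, so the slope can be
  driven to 0 one unit at a time.
\<close>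

lemma flat_descendant:
  assumes \<omega>: "sign_sequence \<omega>"
  shows "\<exists>k i'. i' div 4 ^ k = i \<and> vertex \<omega> (n + k) (i' + 1) = vertex \<omega> (n + k) i'"
proof (induction "nat \<bar>vertex \<omega> n (i + 1) - vertex \<omega> n i\<bar>" arbitrary: n i)
  case 0
  then show ?case by (intro exI[of _ 0] exI[of _ i]) simp
next
  case (Suc m)
  define p q where "p = \<lfloor>\<omega> (2 * n)\<rfloor>" and "q = \<lfloor>\<omega> (2 * n + 1)\<rfloor>"
  have pq: "p \<in> {-1, 1}" "q \<in> {-1, 1}" using sign_floor[OF \<omega>] by (simp_all add: p_def q_def)
  define e where "e = sgn (vertex \<omega> n (i + 1) - vertex \<omega> n i)"
  have e: "e \<in> {-1, 1}" "\<bar>vertex \<omega> n (i + 1) - vertex \<omega> n i - e\<bar> = int m"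
    using Suc.hyps(2) by (auto simp: e_def sgn_if split: if_splits)
  have "\<exists>r\<in>{0, 1, 2, 3}. bump p q (Suc r) - bump p q r = - e"
    using pq e(1) by (auto simp: bump_def)
  then obtain r where "r \<in> {0, 1, 2, 3}" "bump p q (Suc r) - bump p q r = - e" by blast
  then have r: "r < 4" "bump p q (Suc r) - bump p q r = - e" by auto
  have "vertex \<omega> (Suc n) (4 * i + r + 1) - vertex \<omega> (Suc n) (4 * i + r)
      = vertex \<omega> n (i + 1) - vertex \<omega> n i - e"
    using vertex_refine[of r \<omega> n i] vertex_refine[of "Suc r" \<omega> n i] r
      refine_step[of p q "vertex \<omega> n i" "vertex \<omega> n (i + 1)" r]
    by (simp add: p_def q_def del: vertex.simps)
  then have "m = nat \<bar>vertex \<omega> (Suc n) (4 * i + r + 1) - vertex \<omega> (Suc n) (4 * i + r)\<bar>"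
    using e(2) by (simp del: vertex.simps)
  from Suc.hyps(1)[OF this] obtain k i' where
    "i' div 4 ^ k = 4 * i + r" "vertex \<omega> (Suc n + k) (i' + 1) = vertex \<omega> (Suc n + k) i'" by blast
  then show ?case
    using r(1) by (intro exI[of _ "Suc k"] exI[of _ i'])
      (simp add: div_mult2_eq[of i' "4 ^ k" 4] mult.commute[of 4] del: vertex.simps)
qed

text \<open>
  Over a flat segment the graph is a shrunken copy of the graph for the shifted signs, and scaling
  the parametrisation of its Cantor set changes the constant in the Hoelder bound but not the exponent.
\<close>

lemma hausdorff_dim_flat_segment:
  assumes \<omega>: "sign_sequence \<omega>" and "i < 4 ^ n" and flat: "vertex \<omega> n (i + 1) = vertex \<omega> n i"
    and y: "y = 2 / 4 ^ n * of_int (vertex \<omega> n i)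
                + (\<Sum>m. (\<omega> (2 * n + 2 * m) + \<omega> (2 * n + (2 * m + 1))) / 4 ^ (m + 1)) / 4 ^ n"
  shows "hausdorff_dim (level_set (signed_takagi \<omega>) y) = ereal (1/2)"
    and "\<exists>x\<in>{real i / 4 ^ n .. (real i + 1) / 4 ^ n}. signed_takagi \<omega> x = y"
proof -
  define \<tau> where "\<tau> = (\<lambda>k. \<omega> (2 * n + k))"
  have \<tau>: "sign_sequence \<tau>" unfolding \<tau>_def by (rule sign_sequence_shift[OF \<omega>])
  obtain G where G: "\<And>t. t \<in> {0..<1} \<Longrightarrow> G t \<in> {0..1}"
    "\<And>t. t \<in> {0..<1} \<Longrightarrow> signed_takagi \<tau> (G t) = (\<Sum>n. (\<tau> (2 * n) + \<tau> (2 * n + 1)) / 4 ^ (n + 1))"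
    "\<And>s t. s \<in> {0..<1} \<Longrightarrow> t \<in> {0..<1} \<Longrightarrow> \<bar>s - t\<bar> \<le> 4 * dist (G s) (G t) powr (1/2)"
    using cantor_parametrisation[OF \<tau>] by blast
  define H where "H t = (real i + G t) / 4 ^ n" for t
  have H: "H t \<in> {real i / 4 ^ n .. (real i + 1) / 4 ^ n}" "signed_takagi \<omega> (H t) = y" if t: "t \<in> {0..<1}" for t
  proof -
    show "H t \<in> {real i / 4 ^ n .. (real i + 1) / 4 ^ n}"
      using G(1)[OF t] by (simp add: H_def divide_right_mono)
    have "signed_takagi \<omega> (H t) = 2 / 4 ^ n * of_int (vertex \<omega> n i) + signed_takagi \<tau> (G t) / 4 ^ n"
      using signed_takagi_on_segment[OF \<omega>, of "G t" i n] G(1)[OF t]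
      unfolding H_def \<tau>_def flat by (simp add: algebra_simps)
    then show "signed_takagi \<omega> (H t) = y" unfolding G(2)[OF t] unfolding y \<tau>_def .
  qed
  have unit: "{real i / 4 ^ n .. (real i + 1) / 4 ^ n} \<subseteq> {0..1}"
  proof -
    have "real (i + 1) \<le> real (4 ^ n)" using \<open>i < 4 ^ n\<close> by (simp only: of_nat_le_iff Suc_leI Suc_eq_plus1[symmetric])
    then have "(real i + 1) / 4 ^ n \<le> 1" by (simp add: divide_le_eq)
    moreover have "0 \<le> real i / 4 ^ n" by simp
    ultimately show ?thesis unfolding atLeastatMost_subset_iff by blast
  qed
  have "ereal (1/2) \<le> hausdorff_dim (level_set (signed_takagi \<omega>) y)"
  proof (rule hausdorff_dim_ge_holder_inverse[where G = H and C = "4 * 2 ^ n"])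
    show "H t \<in> level_set (signed_takagi \<omega>) y" if "t \<in> {0..<1}" for t
      using subsetD[OF unit H(1)[OF that]] H(2)[OF that] by (simp add: level_set_def)
    show "\<bar>s - t\<bar> \<le> 4 * 2 ^ n * dist (H s) (H t) powr (1/2)" if "s \<in> {0..<1}" "t \<in> {0..<1}" for s t
    proof -
      have "dist (G s) (G t) = 4 ^ n * dist (H s) (H t)"
        by (simp add: H_def dist_real_def diff_divide_distrib[symmetric] abs_divide)
      then have "dist (G s) (G t) powr (1/2) = 2 ^ n * dist (H s) (H t) powr (1/2)"
        by (simp add: powr_mult powr_half_sqrt real_sqrt_power)
      then show ?thesis using G(3)[OF that] by simp
    qed
  qed auto
  then show "hausdorff_dim (level_set (signed_takagi \<omega>) y) = ereal (1/2)"
    using level_set_dim_le_half[OF \<omega>] by (rule antisym[rotated])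
  show "\<exists>x\<in>{real i / 4 ^ n .. (real i + 1) / 4 ^ n}. signed_takagi \<omega> x = y"
    using H[of 0] by (intro bexI[of _ "H 0"]) simp_all
qed

section \<open>The maximal dimension of level sets\<close>

theorem theorem1p1:
  fixes \<omega> :: "nat \<Rightarrow> real" and f :: "real \<Rightarrow> real"
  assumes omega: "\<And>n. \<omega> n \<in> {-1, 1}"
    and f: "\<And>x. x \<in> {0..1} \<Longrightarrow> f x = signed_takagi \<omega> x"
  shows "((\<exists>y. hausdorff_dim (level_set f y) = ereal (1/2)) \<and>
          (\<forall>y. hausdorff_dim (level_set f y) \<le> ereal (1/2))) \<and>
         ({y. hausdorff_dim (level_set f y) = ereal (1/2)} \<subseteq> f ` {0..1} \<and>
          f ` {0..1} \<subseteq> closure {y. hausdorff_dim (level_set f y) = ereal (1/2)}) \<and>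
         hausdorff_dim (level_set f (\<Sum>n. (\<omega> (2 * n) + \<omega> (2 * n + 1)) / 4 ^ (n + 1))) = ereal (1/2)"
proof -
  have \<omega>: "sign_sequence \<omega>" using omega by (simp add: sign_sequence_def)
  have level: "level_set f y = level_set (signed_takagi \<omega>) y" for y
    using f by (auto simp: level_set_def)
  let ?D = "{y. hausdorff_dim (level_set f y) = ereal (1/2)}"
  have upper: "hausdorff_dim (level_set f y) \<le> ereal (1/2)" for y
    unfolding level by (rule level_set_dim_le_half[OF \<omega>])
  have attained: "hausdorff_dim (level_set f (\<Sum>n. (\<omega> (2 * n) + \<omega> (2 * n + 1)) / 4 ^ (n + 1))) = ereal (1/2)"
    unfolding level by (rule hausdorff_dim_flat_segment(1)[OF \<omega>, of 0 0]) simp_all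
  have range: "?D \<subseteq> f ` {0..1}"
  proof
    fix y assume y: "y \<in> ?D"
    have "level_set f y \<noteq> {}" using y hausdorff_dim_empty[where 'a = real] by (auto simp: zero_ereal_def)
    then show "y \<in> f ` {0..1}" by (auto simp: level_set_def)
  qed
  have dense: "f ` {0..1} \<subseteq> closure ?D"
  proof
    fix y assume "y \<in> f ` {0..1}"
    then obtain x where x: "0 \<le> x" "x \<le> 1" "y = signed_takagi \<omega> x" using f by auto
    show "y \<in> closure ?D"
      unfolding closure_approachable
    proof (intro allI impI)
      fix e :: real assume "0 < e"
      then obtain \<delta> where \<delta>: "0 < \<delta>" "\<And>x'. dist x' x < \<delta> \<Longrightarrow> dist (signed_takagi \<omega> x') (signed_takagi \<omega> x) < e"
        using continuous_signed_takagi[OF \<omega>] unfolding continuous_on_iff by blast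
      obtain n where n: "(1/4) ^ n < \<delta>" using real_arch_pow_inv[OF \<delta>(1), of "1/4"] by auto
      obtain i t where i: "i < 4 ^ n" "0 \<le> t" "t \<le> 1" "x = (real i + t) / 4 ^ n"
        by (rule quaternary_interval[OF x(1,2)])
      obtain k j where j: "j div 4 ^ k = i" "vertex \<omega> (n + k) (j + 1) = vertex \<omega> (n + k) j"
        using flat_descendant[OF \<omega>, where i = i and n = n] by blast
      have bounds: "i * 4 ^ k \<le> j" "j + 1 \<le> (i + 1) * 4 ^ k"
      proof -
        have "j = i * 4 ^ k + j mod 4 ^ k" using div_mult_mod_eq[of j "4 ^ k"] j(1) by simp
        moreover have "j mod 4 ^ k < 4 ^ k" by simp
        ultimately show "i * 4 ^ k \<le> j" "j + 1 \<le> (i + 1) * 4 ^ k"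
          unfolding add_mult_distrib by linarith+
      qed
      have "(i + 1) * 4 ^ k \<le> 4 ^ n * 4 ^ k" using i(1) by (intro mult_le_mono1) simp
      then have "j < 4 ^ (n + k)" using bounds(2) unfolding power_add by linarith
      from hausdorff_dim_flat_segment[OF \<omega> this j(2) refl]
      obtain x' where x': "x' \<in> {real j / 4 ^ (n + k) .. (real j + 1) / 4 ^ (n + k)}"
        "hausdorff_dim (level_set (signed_takagi \<omega>) (signed_takagi \<omega> x')) = ereal (1/2)"
        by metis
      have rb: "real i * 4 ^ k \<le> real j" "real j + 1 \<le> (real i + 1) * 4 ^ k"
        using bounds[THEN of_nat_mono[where 'a = real]] by (simp_all add: algebra_simps)
      have "real i / 4 ^ n \<le> real j / 4 ^ (n + k)" "(real j + 1) / 4 ^ (n + k) \<le> (real i + 1) / 4 ^ n"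
      proof -
        have "real i / 4 ^ n = real i * 4 ^ k / 4 ^ (n + k)"
          "(real i + 1) / 4 ^ n = (real i + 1) * 4 ^ k / 4 ^ (n + k)"
          by (simp_all add: power_add)
        then show "real i / 4 ^ n \<le> real j / 4 ^ (n + k)" "(real j + 1) / 4 ^ (n + k) \<le> (real i + 1) / 4 ^ n"
          using rb by (simp_all only: divide_right_mono zero_le_power zero_le_numeral)
      qed
      moreover have "real i / 4 ^ n \<le> x" "x \<le> (real i + 1) / 4 ^ n"
        using i by (simp_all add: divide_right_mono)
      moreover have "(real i + 1) / 4 ^ n - real i / 4 ^ n = (1/4) ^ n"
        by (simp add: add_divide_distrib power_one_over)
      ultimately have "dist x' x \<le> (1/4) ^ n" using x'(1) unfolding dist_real_def by auto
      then have "dist (signed_takagi \<omega> x') y < e" using \<delta>(2)[of x'] n x(3) by simp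
      moreover have "signed_takagi \<omega> x' \<in> ?D" using x'(2) by (simp add: level)
      ultimately show "\<exists>y'\<in>?D. dist y' y < e" by blast
    qed
  qed
  show ?thesis using upper attained range dense by blast
qed

end
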